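(* Let $\mathcal G$ be an étale groupoid whose unit space $\mathcal G^{(0)}$ is second countable. Then $\mathcal A(\mathcal G)=C^*(\mathcal G)$ (both being completions of $\mathcal A_0(\mathcal G)$).
   Context: An étale groupoid $\mathcal G$ is a topological groupoid whose unit space $\mathcal G^{(0)}$ is locally compact Hausdorff and whose source and range maps $\mathbf d,\mathbf r:\mathcal G\to\mathcal G^{(0)}$ are local homeomorphisms; $\mathcal G$ need not be Hausdorff. A bisection is an open set $U\subseteq\mathcal G$ on which $\mathbf d$ and $\mathbf r$ are injective. For an open Hausdorff $V\subseteq\mathcal G$, $C_c(V)$ denotes the functions $f:\mathcal G\to\mathbb C$ vanishing off $V$ whose restriction to $V$ is continuous with compact support. $\mathcal A_0(\mathcal G)$ is the linear span of all $C_c(V)$, $V$ open Hausdorff; it is an algebra under $(f*g)(z)=\sum_{xy=z}f(x)g(y)$, and has the involution $f^*(x)=\overline{f(x^{-1})}$. A representation of $\mathcal A_0(\mathcal G)$ is an algebra homomorphism $\pi:\mathcal A_0(\mathcal G)\to B(H)$, $H$ a Hilbert space, with $\|\pi(f)\|\le\|f\|_\infty$ for every bisection $U$ and $f\in C_c(U)$, and $\pi(\overline f)=\pi(f)^*$ for $f\in C_c(\mathcal G^{(0)})$ (it is not assumed to be a $*$-homomorphism). $\mathcal A(\mathcal G)$ is the Hausdorff completion of $\mathcal A_0(\mathcal G)$ in the seminorm $\sup_\pi\|\pi(f)\|$ over all such representations. $C^*(\mathcal G)$ is the completion of $\mathcal A_0(\mathcal G)$ in the norm $\sup_\pi\|\pi(f)\|$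 over all $*$-representations of $\mathcal A_0(\mathcal G)$ on Hilbert spaces. The equality means that the two (semi)norms on $\mathcal A_0(\mathcal G)$ are equal. *)

theory Defs
  imports
    "HOL-Analysis.Analysis"
    "HOL-Library.Function_Algebras"
    "HOL-Algebra.Module"
begin

section \<open>Topological and etale groupoids\<close>

text \<open>The set of arrows is the carrier \<^term>\<open>topspace\<close> of the topology. The product \<open>xy\<close> is defined
  when the source of \<open>x\<close> is the range of \<open>y\<close>; the values of \<open>gmul\<close> on other pairs are irrelevant.\<close>

record 'g groupoid =
  gtop :: "'g topology"
  src  :: "'g \<Rightarrow> 'g"
  rng  :: "'g \<Rightarrow> 'g"
  gmul :: "'g \<Rightarrow> 'g \<Rightarrow> 'g"
  ginv :: "'g \<Rightarrow> 'g"

definition arrows :: "'g groupoid \<Rightarrow> 'g set" where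
  "arrows G = topspace (gtop G)"

definition units :: "'g groupoid \<Rightarrow> 'g set" where
  "units G = src G ` arrows G"

definition composable :: "'g groupoid \<Rightarrow> ('g \<times> 'g) set" where
  "composable G = {(x, y). x \<in> arrows G \<and> y \<in> arrows G \<and> src G x = rng G y}"

locale algebraic_groupoid =
  fixes G :: "'g groupoid"
  assumes src_in: "x \<in> arrows G \<Longrightarrow> src G x \<in> arrows G"
    and rng_in: "x \<in> arrows G \<Longrightarrow> rng G x \<in> arrows G"
    and src_src: "x \<in> arrows G \<Longrightarrow> src G (src G x) = src G x"
    and rng_src: "x \<in> arrows G \<Longrightarrow> rng G (src G x) = src G x"
    and src_rng: "x \<in> arrows G \<Longrightarrow> src G (rng G x) = rng G x"
    and rng_rng: "x \<in> arrows G \<Longrightarrow> rng G (rng G x) = rng G x"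
    and mul_in: "(x, y) \<in> composable G \<Longrightarrow> gmul G x y \<in> arrows G"
    and src_mul: "(x, y) \<in> composable G \<Longrightarrow> src G (gmul G x y) = src G y"
    and rng_mul: "(x, y) \<in> composable G \<Longrightarrow> rng G (gmul G x y) = rng G x"
    and mul_assoc: "(x, y) \<in> composable G \<Longrightarrow> (y, z) \<in> composable G \<Longrightarrow>
      gmul G (gmul G x y) z = gmul G x (gmul G y z)"
    and mul_src: "x \<in> arrows G \<Longrightarrow> gmul G x (src G x) = x"
    and rng_mul_self: "x \<in> arrows G \<Longrightarrow> gmul G (rng G x) x = x"
    and inv_in: "x \<in> arrows G \<Longrightarrow> ginv G x \<in> arrows G"
    and src_inv: "x \<in> arrows G \<Longrightarrow> src G (ginv G x) = rng G x"
    and rng_inv: "x \<in> arrows G \<Longrightarrow> rng G (ginv G x) = src G x"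
    and inv_mul: "x \<in> arrows G \<Longrightarrow> gmul G (ginv G x) x = src G x"
    and mul_inv: "x \<in> arrows G \<Longrightarrow> gmul G x (ginv G x) = rng G x"

locale topological_groupoid = algebraic_groupoid +
  assumes continuous_mul:
      "continuous_map (subtopology (prod_topology (gtop G) (gtop G)) (composable G)) (gtop G)
         (\<lambda>(x, y). gmul G x y)"
    and continuous_inv: "continuous_map (gtop G) (gtop G) (ginv G)"

definition unit_space :: "'g groupoid \<Rightarrow> 'g topology" where
  "unit_space G = subtopology (gtop G) (units G)"

definition local_homeomorphism :: "'a topology \<Rightarrow> 'b topology \<Rightarrow> ('a \<Rightarrow> 'b) \<Rightarrow> bool" where
  "local_homeomorphism X Y f \<longleftrightarrow>
     (\<forall>x \<in> topspace X. \<exists>U. openin X U \<and> x \<in> U \<and> openin Y (f ` U) \<and>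
        homeomorphic_map (subtopology X U) (subtopology Y (f ` U)) f)"

locale etale_groupoid = topological_groupoid +
  assumes Hausdorff_unit_space: "Hausdorff_space (unit_space G)"
    and locally_compact_unit_space: "locally_compact_space (unit_space G)"
    and local_homeomorphism_src: "local_homeomorphism (gtop G) (unit_space G) (src G)"
    and local_homeomorphism_rng: "local_homeomorphism (gtop G) (unit_space G) (rng G)"

definition bisection :: "'g groupoid \<Rightarrow> 'g set \<Rightarrow> bool" where
  "bisection G U \<longleftrightarrow> openin (gtop G) U \<and> inj_on (src G) U \<and> inj_on (rng G) U"


section \<open>The convolution algebra\<close>

definition open_Hausdorff :: "'g groupoid \<Rightarrow> 'g set \<Rightarrow> bool" where
  "open_Hausdorff G V \<longleftrightarrow> openin (gtop G) V \<and> Hausdorff_space (subtopology (gtop G) V)"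

text \<open>Continuity and support are taken relative to \<open>V\<close>: when the groupoid is not Hausdorff, such a
  function need not be continuous on the groupoid, and its support in \<open>V\<close> need not be closed there.\<close>

definition Cc :: "'g groupoid \<Rightarrow> 'g set \<Rightarrow> ('g \<Rightarrow> complex) set" where
  "Cc G V = {f. (\<forall>x. x \<notin> V \<longrightarrow> f x = 0) \<and>
     continuous_map (subtopology (gtop G) V) euclidean f \<and>
     compactin (subtopology (gtop G) V) (subtopology (gtop G) V closure_of {x \<in> V. f x \<noteq> 0})}"

text \<open>\<open>Modules.module.span\<close> is the linear span of HOL's vector space theory, here for complex scalars.\<close>

definition fscale :: "complex \<Rightarrow> ('g \<Rightarrow> complex) \<Rightarrow> 'g \<Rightarrow> complex" where
  "fscale c f = (\<lambda>x. c * f x)"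

definition A0 :: "'g groupoid \<Rightarrow> ('g \<Rightarrow> complex) set" where
  "A0 G = Modules.module.span fscale (\<Union>V \<in> Collect (open_Hausdorff G). Cc G V)"

text \<open>A sum over an infinite set is \<open>0\<close> in HOL, and the set of factorisations \<open>z = xy\<close> may be infinite,
  so the sum is restricted to its nonzero terms. For \<open>f\<close> and \<open>g\<close> in \<^term>\<open>A0 G\<close>, \<open>G\<close> etale, there are
  only finitely many of these.\<close>

definition conv :: "'g groupoid \<Rightarrow> ('g \<Rightarrow> complex) \<Rightarrow> ('g \<Rightarrow> complex) \<Rightarrow> 'g \<Rightarrow> complex" where
  "conv G f g = (\<lambda>z. \<Sum>(x, y) \<in> {(x, y) \<in> composable G. gmul G x y = z \<and> f x * g y \<noteq> 0}. f x * g y)"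

text \<open>Extended by \<open>0\<close> to the points of the type that are not arrows.\<close>

definition star :: "'g groupoid \<Rightarrow> ('g \<Rightarrow> complex) \<Rightarrow> 'g \<Rightarrow> complex" where
  "star G f = (\<lambda>x. if x \<in> arrows G then cnj (f (ginv G x)) else 0)"

text \<open>The supremum is over the whole type, which changes nothing for functions that vanish off the
  arrows and gives \<open>0\<close> on the empty groupoid.\<close>

definition supnorm :: "('g \<Rightarrow> complex) \<Rightarrow> real" where
  "supnorm f = (SUP x. cmod (f x))"


section \<open>Hilbert spaces\<close>

text \<open>Representations on all Hilbert spaces have to be collected in one supremum, so Hilbert spaces
  are structures on subsets of a type rather than types of a type class. The fields \<open>mult\<close> and \<open>one\<close>
  inherited from the record of modules play no role. The inner product is linear in the first
  variable.\<close>

definition complex_field :: "complex ring" where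
  "complex_field = \<lparr>carrier = UNIV, monoid.mult = (*), one = 1, zero = 0, add = (+)\<rparr>"

record 'h hilbert = "(complex, 'h) module" +
  hinner :: "'h \<Rightarrow> 'h \<Rightarrow> complex"

definition hnorm :: "'h hilbert \<Rightarrow> 'h \<Rightarrow> real" where
  "hnorm H \<xi> = sqrt (Re (hinner H \<xi> \<xi>))"

text \<open>The value off the carrier is set to \<open>0\<close> because the locale \<^locale>\<open>Metric_space\<close> demands
  nonnegativity and symmetry of the distance on the whole type.\<close>

definition hdist :: "'h hilbert \<Rightarrow> 'h \<Rightarrow> 'h \<Rightarrow> real" where
  "hdist H \<xi> \<eta> = (if \<xi> \<in> carrier H \<and> \<eta> \<in> carrier H then hnorm H (\<xi> \<ominus>\<^bsub>H\<^esub> \<eta>) else 0)"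

locale inner_product_space = Module.module complex_field H for H :: "'h hilbert" +
  assumes inner_add_left: "\<xi> \<in> carrier H \<Longrightarrow> \<xi>' \<in> carrier H \<Longrightarrow> \<eta> \<in> carrier H \<Longrightarrow>
      hinner H (\<xi> \<oplus>\<^bsub>H\<^esub> \<xi>') \<eta> = hinner H \<xi> \<eta> + hinner H \<xi>' \<eta>"
    and inner_smult_left: "\<xi> \<in> carrier H \<Longrightarrow> \<eta> \<in> carrier H \<Longrightarrow>
      hinner H (c \<odot>\<^bsub>H\<^esub> \<xi>) \<eta> = c * hinner H \<xi> \<eta>"
    and inner_cnj: "\<xi> \<in> carrier H \<Longrightarrow> \<eta> \<in> carrier H \<Longrightarrow> hinner H \<eta> \<xi> = cnj (hinner H \<xi> \<eta>)"
    and inner_pos: "\<xi> \<in> carrier H \<Longrightarrow> \<xi> \<noteq> \<zero>\<^bsub>H\<^esub> \<Longrightarrow> 0 < Re (hinner H \<xi> \<xi>)"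

locale hilbert_space = inner_product_space +
  assumes complete: "Metric_space.mcomplete (carrier H) (hdist H)"

text \<open>Operators are functions on the type, and only their restriction to the carrier matters.\<close>

definition bounded_operators :: "'h hilbert \<Rightarrow> ('h \<Rightarrow> 'h) set" where
  "bounded_operators H = {T. T \<in> carrier H \<rightarrow> carrier H \<and>
     (\<forall>\<xi> \<in> carrier H. \<forall>\<eta> \<in> carrier H. T (\<xi> \<oplus>\<^bsub>H\<^esub> \<eta>) = T \<xi> \<oplus>\<^bsub>H\<^esub> T \<eta>) \<and>
     (\<forall>c. \<forall>\<xi> \<in> carrier H. T (c \<odot>\<^bsub>H\<^esub> \<xi>) = c \<odot>\<^bsub>H\<^esub> T \<xi>) \<and>
     (\<exists>B. \<forall>\<xi> \<in> carrier H. hnorm H (T \<xi>) \<le> B * hnorm H \<xi>)}"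

definition opnorm :: "'h hilbert \<Rightarrow> ('h \<Rightarrow> 'h) \<Rightarrow> real" where
  "opnorm H T = (SUP \<xi> \<in> {\<xi> \<in> carrier H. hnorm H \<xi> \<le> 1}. hnorm H (T \<xi>))"

text \<open>\<open>S\<close> is the adjoint of \<open>T\<close>.\<close>

definition is_adjoint :: "'h hilbert \<Rightarrow> ('h \<Rightarrow> 'h) \<Rightarrow> ('h \<Rightarrow> 'h) \<Rightarrow> bool" where
  "is_adjoint H T S \<longleftrightarrow>
     (\<forall>\<xi> \<in> carrier H. \<forall>\<eta> \<in> carrier H. hinner H (T \<xi>) \<eta> = hinner H \<xi> (S \<eta>))"


section \<open>Representations and the two seminorms\<close>

definition algebra_hom :: "'g groupoid \<Rightarrow> 'h hilbert \<Rightarrow> (('g \<Rightarrow> complex) \<Rightarrow> 'h \<Rightarrow> 'h) \<Rightarrow> bool" where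
  "algebra_hom G H \<pi> \<longleftrightarrow>
     (\<forall>f \<in> A0 G. \<pi> f \<in> bounded_operators H) \<and>
     (\<forall>f \<in> A0 G. \<forall>g \<in> A0 G. \<forall>\<xi> \<in> carrier H. \<pi> (f + g) \<xi> = \<pi> f \<xi> \<oplus>\<^bsub>H\<^esub> \<pi> g \<xi>) \<and>
     (\<forall>c. \<forall>f \<in> A0 G. \<forall>\<xi> \<in> carrier H. \<pi> (fscale c f) \<xi> = c \<odot>\<^bsub>H\<^esub> \<pi> f \<xi>) \<and>
     (\<forall>f \<in> A0 G. \<forall>g \<in> A0 G. \<forall>\<xi> \<in> carrier H. \<pi> (conv G f g) \<xi> = \<pi> f (\<pi> g \<xi>))"

definition representation :: "'g groupoid \<Rightarrow> 'h hilbert \<Rightarrow> (('g \<Rightarrow> complex) \<Rightarrow> 'h \<Rightarrow> 'h) \<Rightarrow> bool" where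
  "representation G H \<pi> \<longleftrightarrow> algebra_hom G H \<pi> \<and>
     (\<forall>U f. bisection G U \<longrightarrow> f \<in> Cc G U \<longrightarrow> opnorm H (\<pi> f) \<le> supnorm f) \<and>
     (\<forall>f \<in> Cc G (units G). is_adjoint H (\<pi> f) (\<pi> (\<lambda>x. cnj (f x))))"

definition star_representation :: "'g groupoid \<Rightarrow> 'h hilbert \<Rightarrow> (('g \<Rightarrow> complex) \<Rightarrow> 'h \<Rightarrow> 'h) \<Rightarrow> bool" where
  "star_representation G H \<pi> \<longleftrightarrow> algebra_hom G H \<pi> \<and>
     (\<forall>f \<in> A0 G. is_adjoint H (\<pi> f) (\<pi> (star G f)))"

text \<open>HOL has no supremum over all Hilbert spaces. The suprema below range over all Hilbert spaces
  (of any dimension) whose points are elements of a type \<open>'h\<close>, which a theorem leaves arbitrary.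
  Every set of Hilbert spaces has isometric copies inside one suitable type. In fact
  \<open>'h = 'g \<Rightarrow> complex\<close> is large enough: to compute \<open>\<parallel>\<pi> f \<xi>\<parallel>\<close> one may restrict \<open>\<pi>\<close> to the closed invariant
  subspace generated by the single vector \<open>\<xi>\<close>, which has at most as many points as this type. The
  suprema are taken in \<^typ>\<open>ennreal\<close>, so that they are genuine suprema without a proof of boundedness.\<close>

definition A_seminorm :: "'h itself \<Rightarrow> 'g groupoid \<Rightarrow> ('g \<Rightarrow> complex) \<Rightarrow> ennreal" where
  "A_seminorm _ G f =
     Sup {ennreal (opnorm H (\<pi> f)) |(H :: 'h hilbert) \<pi>. hilbert_space H \<and> representation G H \<pi>}"

definition Cstar_norm :: "'h itself \<Rightarrow> 'g groupoid \<Rightarrow> ('g \<Rightarrow> complex) \<Rightarrow> ennreal" where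
  "Cstar_norm _ G f =
     Sup {ennreal (opnorm H (\<pi> f)) |(H :: 'h hilbert) \<pi>. hilbert_space H \<and> star_representation G H \<pi>}"

end

theory Submission
  imports Defs
begin

text \<open>The two seminorms agree because they are suprema over the same set: on every Hilbert space the
  representations are exactly the \<open>*\<close>-representations (\<open>representation_iff_star_representation\<close>).

  Let \<open>\<pi>\<close> be a representation and \<open>f \<in> C\<^sub>c(U)\<close> for a bisection \<open>U\<close>. Choose \<open>k \<in> C\<^sub>c(U)\<close> with values in
  \<open>[0, 1]\<close> that is \<open>1\<close> on the support of \<open>f\<close>, and let \<open>g\<close> be \<open>f\<close> moved to the unit space along the source
  map. Then \<open>f = k * g\<close>, \<open>g = k\<^sup>* * f\<close> and \<open>f\<^sup>* = cnj(g) * k\<^sup>*\<close>. As \<open>k\<close> and \<open>k\<^sup>*\<close> live on bisections,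
  \<open>\<pi>(k)\<close> and \<open>b = \<pi>(k\<^sup>*)\<close> are contractions, and they carry \<open>\<pi>(g)\<eta>\<close> to \<open>u = \<pi>(f)\<eta>\<close> and back; hence \<open>b\<close>
  preserves the norm of \<open>u\<close>. A contraction that preserves the norm of a vector preserves its inner
  product with every vector (\<open>contraction_preserves_inner\<close>), so
  \<open>\<langle>\<pi>(f)\<eta>, \<zeta>\<rangle> = \<langle>b u, b \<zeta>\<rangle> = \<langle>\<pi>(g)\<eta>, \<pi>(k\<^sup>*)\<zeta>\<rangle>\<close>, and moving \<open>\<pi>(g)\<close> to the other side, which is allowed on
  the unit space, gives \<open>\<langle>\<eta>, \<pi>(f\<^sup>*)\<zeta>\<rangle>\<close>. A partition argument shows that such \<open>f\<close> span the algebra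
  (\<open>A0_eq_span_bisections\<close>).

  Conversely, let \<open>\<pi>\<close> be a \<open>*\<close>-representation, \<open>f \<in> C\<^sub>c(U)\<close> and \<open>M = \<parallel>f\<parallel>\<^sub>\<infinity>\<close>. The function \<open>h = f\<^sup>* * f\<close> lives
  on the unit space and satisfies \<open>0 \<le> h \<le> M\<^sup>2\<close>. The
  square root of \<open>M\<^sup>2 - h\<close> is in general not compactly supported, but it has the form \<open>M - t\<close> with \<open>t\<close> compactly
  supported, and
  \<open>M\<^sup>2\<parallel>\<xi>\<parallel>\<^sup>2 - \<parallel>\<pi>(f)\<xi>\<parallel>\<^sup>2 = \<parallel>M\<xi> - \<pi>(t)\<xi>\<parallel>\<^sup>2 \<ge> 0\<close>.\<close>

section \<open>Contractions of inner product spaces\<close>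

context inner_product_space
begin

lemma smult_in [simp]: "\<xi> \<in> carrier H \<Longrightarrow> c \<odot>\<^bsub>H\<^esub> \<xi> \<in> carrier H"
  using smult_closed[of c \<xi>] by (simp add: complex_field_def)

lemma smult_zero_left: "\<xi> \<in> carrier H \<Longrightarrow> 0 \<odot>\<^bsub>H\<^esub> \<xi> = \<zero>\<^bsub>H\<^esub>"
  using smult_l_null[of \<xi>] by (simp add: complex_field_def)

lemma inner_add_right:
  assumes "\<xi> \<in> carrier H" "\<eta> \<in> carrier H" "\<eta>' \<in> carrier H"
  shows "hinner H \<xi> (\<eta> \<oplus>\<^bsub>H\<^esub> \<eta>') = hinner H \<xi> \<eta> + hinner H \<xi> \<eta>'"
  using assms inner_cnj[of "\<eta> \<oplus>\<^bsub>H\<^esub> \<eta>'" \<xi>] inner_cnj[of \<eta> \<xi>] inner_cnj[of \<eta>' \<xi>]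
  by (simp add: inner_add_left)

lemma inner_smult_right:
  assumes "\<xi> \<in> carrier H" "\<eta> \<in> carrier H"
  shows "hinner H \<xi> (c \<odot>\<^bsub>H\<^esub> \<eta>) = cnj c * hinner H \<xi> \<eta>"
  using assms inner_cnj[of "c \<odot>\<^bsub>H\<^esub> \<eta>" \<xi>] inner_cnj[of \<eta> \<xi>] by (simp add: inner_smult_left)

lemma inner_zero_left: "\<xi> \<in> carrier H \<Longrightarrow> hinner H \<zero>\<^bsub>H\<^esub> \<xi> = 0"
  using inner_smult_left[of \<xi> \<xi> 0] by (simp add: smult_zero_left)

lemma Re_inner_self_nonneg: "\<xi> \<in> carrier H \<Longrightarrow> 0 \<le> Re (hinner H \<xi> \<xi>)"
  using inner_pos[of \<xi>] inner_zero_left[of \<xi>] by (cases "\<xi> = \<zero>\<^bsub>H\<^esub>") auto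

lemma hnorm_nonneg: "\<xi> \<in> carrier H \<Longrightarrow> 0 \<le> hnorm H \<xi>"
  by (simp add: hnorm_def Re_inner_self_nonneg)

lemma hnorm_square: "\<xi> \<in> carrier H \<Longrightarrow> (hnorm H \<xi>)\<^sup>2 = Re (hinner H \<xi> \<xi>)"
  by (simp add: hnorm_def Re_inner_self_nonneg)

lemma hnorm_zero [simp]: "hnorm H \<zero>\<^bsub>H\<^esub> = 0"
  by (simp add: hnorm_def inner_zero_left)

lemma hnorm_eq_0: "\<xi> \<in> carrier H \<Longrightarrow> hnorm H \<xi> = 0 \<Longrightarrow> \<xi> = \<zero>\<^bsub>H\<^esub>"
  using inner_pos[of \<xi>] by (auto simp: hnorm_def)

lemma hnorm_smult: 
  assumes "\<xi> \<in> carrier H"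
  shows "hnorm H (c \<odot>\<^bsub>H\<^esub> \<xi>) = cmod c * hnorm H \<xi>"
proof -
  have "hinner H (c \<odot>\<^bsub>H\<^esub> \<xi>) (c \<odot>\<^bsub>H\<^esub> \<xi>) = of_real ((cmod c)\<^sup>2) * hinner H \<xi> \<xi>"
    using assms by (simp add: inner_smult_left inner_smult_right complex_norm_square mult_ac
        del: of_real_power)
  then show ?thesis
    by (simp add: hnorm_def real_sqrt_mult)
qed

lemma hnorm_add_smult_square:
  assumes "\<xi> \<in> carrier H" "\<eta> \<in> carrier H"
  shows "(hnorm H (\<xi> \<oplus>\<^bsub>H\<^esub> c \<odot>\<^bsub>H\<^esub> \<eta>))\<^sup>2
    = (hnorm H \<xi>)\<^sup>2 + 2 * Re (cnj c * hinner H \<xi> \<eta>) + (cmod c)\<^sup>2 * (hnorm H \<eta>)\<^sup>2"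
proof -
  have "hinner H (\<xi> \<oplus>\<^bsub>H\<^esub> c \<odot>\<^bsub>H\<^esub> \<eta>) (\<xi> \<oplus>\<^bsub>H\<^esub> c \<odot>\<^bsub>H\<^esub> \<eta>)
      = hinner H \<xi> \<xi> + (cnj c * hinner H \<xi> \<eta> + cnj (cnj c * hinner H \<xi> \<eta>))
        + hinner H (c \<odot>\<^bsub>H\<^esub> \<eta>) (c \<odot>\<^bsub>H\<^esub> \<eta>)"
    using assms inner_cnj[of \<xi> \<eta>] by (simp add: inner_add_left inner_add_right inner_smult_left inner_smult_right algebra_simps)
  then have "Re (hinner H (\<xi> \<oplus>\<^bsub>H\<^esub> c \<odot>\<^bsub>H\<^esub> \<eta>) (\<xi> \<oplus>\<^bsub>H\<^esub> c \<odot>\<^bsub>H\<^esub> \<eta>))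
      = Re (hinner H \<xi> \<xi>) + 2 * Re (cnj c * hinner H \<xi> \<eta>) + Re (hinner H (c \<odot>\<^bsub>H\<^esub> \<eta>) (c \<odot>\<^bsub>H\<^esub> \<eta>))"
    by simp
  then show ?thesis
    using assms by (simp add: hnorm_square[symmetric] hnorm_smult power_mult_distrib)
qed

text \<open>The form \<open>\<langle>v, w\<rangle> - \<langle>T v, T w\<rangle>\<close> is positive semidefinite and vanishes at \<open>(u, u)\<close>, hence, by
  Cauchy and Schwarz, at \<open>(v, u)\<close> for every \<open>v\<close>. The argument replaces the identity
  \<open>T\<^sup>*T u = u\<close>, so that no adjoint of \<open>T\<close> has to be constructed.\<close>
lemma contraction_preserves_inner:
  assumes T: "T \<in> bounded_operators H"
    and contr: "\<And>\<xi>. \<xi> \<in> carrier H \<Longrightarrow> hnorm H (T \<xi>) \<le> hnorm H \<xi>"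
    and u: "u \<in> carrier H" "hnorm H u \<le> hnorm H (T u)"
    and v: "v \<in> carrier H"
  shows "hinner H (T v) (T u) = hinner H v u"
proof -
  define d where "d = hinner H v u - hinner H (T v) (T u)"
  define q where "q = (hnorm H v)\<^sup>2 - (hnorm H (T v))\<^sup>2"
  have Tc: "T u \<in> carrier H" "T v \<in> carrier H"
    using T u v by (auto simp: bounded_operators_def)
  have nu: "hnorm H (T u) = hnorm H u"
    using contr[of u] u by simp
  have main: "0 \<le> q + 2 * Re (cnj c * d)" for c
  proof -
    have "T (v \<oplus>\<^bsub>H\<^esub> c \<odot>\<^bsub>H\<^esub> u) = T v \<oplus>\<^bsub>H\<^esub> c \<odot>\<^bsub>H\<^esub> T u"
      using T u v by (simp add: bounded_operators_def)
    then have "hnorm H (T v \<oplus>\<^bsub>H\<^esub> c \<odot>\<^bsub>H\<^esub> T u) \<le> hnorm H (v \<oplus>\<^bsub>H\<^esub> c \<odot>\<^bsub>H\<^esub> u)"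
      using contr[of "v \<oplus>\<^bsub>H\<^esub> c \<odot>\<^bsub>H\<^esub> u"] u v by simp
    then have "(hnorm H (T v \<oplus>\<^bsub>H\<^esub> c \<odot>\<^bsub>H\<^esub> T u))\<^sup>2 \<le> (hnorm H (v \<oplus>\<^bsub>H\<^esub> c \<odot>\<^bsub>H\<^esub> u))\<^sup>2"
      using Tc by (intro power_mono hnorm_nonneg) auto
    then show ?thesis
      using u v Tc nu by (simp add: hnorm_add_smult_square q_def d_def algebra_simps)
  qed
  have "d = 0"
  proof (rule ccontr)
    assume "d \<noteq> 0"
    \<comment> \<open>The scalar is chosen to make the nonnegative quantity of \<open>main\<close> equal to \<open>-1\<close>.\<close>
    define c where "c = - of_real ((q + 1) / (2 * (cmod d)\<^sup>2)) * d"
    have "cnj c * d = - of_real ((q + 1) / (2 * (cmod d)\<^sup>2)) * (d * cnj d)"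
      by (simp add: c_def)
    also have "\<dots> = of_real (- ((q + 1) / 2))"
      using \<open>d \<noteq> 0\<close> by (simp add: complex_norm_square[symmetric])
    finally have "Re (cnj c * d) = - ((q + 1) / 2)"
      by (simp only: Re_complex_of_real)
    then have "q + 2 * Re (cnj c * d) = -1"
      by (simp add: field_simps)
    with main[of c] show False
      by simp
  qed
  then show ?thesis
    by (simp add: d_def)
qed

lemma hnorm_le_opnorm:
  assumes T: "T \<in> bounded_operators H" and "\<xi> \<in> carrier H"
  shows "hnorm H (T \<xi>) \<le> opnorm H T * hnorm H \<xi>"
proof (cases "\<xi> = \<zero>\<^bsub>H\<^esub>")
  case True
  have "T (0 \<odot>\<^bsub>H\<^esub> \<xi>) = 0 \<odot>\<^bsub>H\<^esub> T \<xi>" "T \<xi> \<in> carrier H"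
    using assms by (auto simp: bounded_operators_def)
  then show ?thesis
    using assms True by (simp add: smult_zero_left)
next
  case False
  define n where "n = hnorm H \<xi>"
  have n: "n > 0"
    using False hnorm_eq_0[of \<xi>] hnorm_nonneg[of \<xi>] assms by (force simp: n_def)
  obtain B where B: "\<And>\<xi>. \<xi> \<in> carrier H \<Longrightarrow> hnorm H (T \<xi>) \<le> B * hnorm H \<xi>"
    using T unfolding bounded_operators_def by blast
  have Tc: "T \<xi> \<in> carrier H"
    using assms by (auto simp: bounded_operators_def)
  have "bdd_above ((\<lambda>\<xi>. hnorm H (T \<xi>)) ` {\<xi> \<in> carrier H. hnorm H \<xi> \<le> 1})"
  proof (rule bdd_aboveI2)
    fix \<eta> assume \<eta>: "\<eta> \<in> {\<xi> \<in> carrier H. hnorm H \<xi> \<le> 1}"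
    then have "B * hnorm H \<eta> \<le> \<bar>B\<bar> * 1"
      using hnorm_nonneg[of \<eta>] by (intro mult_mono) auto
    with B[of \<eta>] \<eta> show "hnorm H (T \<eta>) \<le> \<bar>B\<bar>"
      by simp
  qed
  moreover have "of_real (1 / n) \<odot>\<^bsub>H\<^esub> \<xi> \<in> {\<xi> \<in> carrier H. hnorm H \<xi> \<le> 1}"
    using assms n by (simp add: hnorm_smult n_def norm_divide)
  ultimately have "hnorm H (T (of_real (1 / n) \<odot>\<^bsub>H\<^esub> \<xi>)) \<le> opnorm H T"
    unfolding opnorm_def by (rule cSUP_upper2) auto
  moreover have "T (of_real (1 / n) \<odot>\<^bsub>H\<^esub> \<xi>) = of_real (1 / n) \<odot>\<^bsub>H\<^esub> T \<xi>"
    using assms by (simp add: bounded_operators_def)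
  ultimately show ?thesis
    using Tc n by (simp add: hnorm_smult norm_divide field_simps flip: n_def)
qed

lemma opnorm_least:
  assumes "0 \<le> C" and "\<And>\<xi>. \<xi> \<in> carrier H \<Longrightarrow> hnorm H (T \<xi>) \<le> C * hnorm H \<xi>"
  shows "opnorm H T \<le> C"
  unfolding opnorm_def
proof (rule cSUP_least)
  show "{\<xi> \<in> carrier H. hnorm H \<xi> \<le> 1} \<noteq> {}"
    using hnorm_zero by force
next
  fix \<xi> assume "\<xi> \<in> {\<xi> \<in> carrier H. hnorm H \<xi> \<le> 1}"
  then have "hnorm H (T \<xi>) \<le> C * hnorm H \<xi>" "C * hnorm H \<xi> \<le> C * 1"
    using assms by (auto intro: mult_left_le)
  then show "hnorm H (T \<xi>) \<le> C"
    by simp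
qed

end

section \<open>Compactly supported functions\<close>

lemma open_Hausdorff_subset:
  assumes "open_Hausdorff G V" "openin (gtop G) W" "W \<subseteq> V"
  shows "open_Hausdorff G W"
proof -
  have "subtopology (gtop G) W = subtopology (subtopology (gtop G) V) W"
    using assms by (simp add: subtopology_subtopology inf.absorb2)
  then show ?thesis
    using assms by (simp add: open_Hausdorff_def Hausdorff_space_subtopology)
qed

text \<open>In a Hausdorff set the closure of the set of nonzero values may be replaced by any compact set
  off which the function vanishes.\<close>
lemma Cc_iff:
  assumes V: "open_Hausdorff G V"
  shows "f \<in> Cc G V \<longleftrightarrow> continuous_map (subtopology (gtop G) V) euclidean f \<and>
    (\<exists>K. compactin (gtop G) K \<and> K \<subseteq> V \<and> (\<forall>x. x \<notin> K \<longrightarrow> f x = 0))"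
proof -
  let ?X = "subtopology (gtop G) V" and ?S = "{x \<in> V. f x \<noteq> 0}"
  have S: "?S \<subseteq> ?X closure_of ?S"
    using V by (intro closure_of_subset) (auto simp: open_Hausdorff_def dest: openin_subset)
  show ?thesis
  proof
    assume f: "f \<in> Cc G V"
    then show "continuous_map ?X euclidean f \<and>
        (\<exists>K. compactin (gtop G) K \<and> K \<subseteq> V \<and> (\<forall>x. x \<notin> K \<longrightarrow> f x = 0))"
      using S by (intro conjI exI[of _ "?X closure_of ?S"]) (auto simp: Cc_def compactin_subtopology)
  next
    assume "continuous_map ?X euclidean f \<and>
        (\<exists>K. compactin (gtop G) K \<and> K \<subseteq> V \<and> (\<forall>x. x \<notin> K \<longrightarrow> f x = 0))"
    then obtain K where f: "continuous_map ?X euclidean f"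
      and K: "compactin ?X K" "K \<subseteq> V" "\<And>x. x \<notin> K \<Longrightarrow> f x = 0"
      by (auto simp: compactin_subtopology)
    have "closedin ?X K"
      using V K(1) unfolding open_Hausdorff_def by (blast intro: compactin_imp_closedin)
    moreover have "?S \<subseteq> K"
      using K(3) by blast
    ultimately have "?X closure_of ?S \<subseteq> K"
      by (rule closure_of_minimal[rotated])
    then have "compactin ?X (?X closure_of ?S)"
      by (rule closed_compactin[OF K(1) _ closedin_closure_of])
    then show "f \<in> Cc G V"
      using f K(2,3) unfolding Cc_def by blast
  qed
qed

lemma CcD:
  assumes "f \<in> Cc G V"
  shows "continuous_map (subtopology (gtop G) V) euclidean f" "\<And>x. x \<notin> V \<Longrightarrow> f x = 0"
  using assms by (auto simp: Cc_def)

text \<open>A compact subset of \<open>W\<close> is closed in the Hausdorff set \<open>V\<close>, so that the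
  function is continuous on the two open sets \<open>W\<close> and \<open>V - K\<close>, on the second because it is \<open>0\<close> there.\<close>
lemma Cc_extend:
  assumes f: "f \<in> Cc G W" and V: "open_Hausdorff G V" and W: "openin (gtop G) W" "W \<subseteq> V"
  shows "f \<in> Cc G V"
proof -
  let ?X = "subtopology (gtop G) V"
  have "open_Hausdorff G W"
    using V W by (rule open_Hausdorff_subset)
  then obtain K where fW: "continuous_map (subtopology (gtop G) W) euclidean f"
    and K: "compactin (gtop G) K" "K \<subseteq> W" "\<And>x. x \<notin> K \<Longrightarrow> f x = 0"
    using f by (auto simp: Cc_iff)
  have "closedin ?X K"
    using V K(1,2) W unfolding open_Hausdorff_def
    by (intro compactin_imp_closedin) (auto simp: compactin_subtopology)
  then have "openin ?X (topspace ?X - K)"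
    by blast
  moreover have "openin ?X W"
    using W by (simp add: subset_openin_subtopology)
  moreover have "continuous_map (subtopology ?X (topspace ?X - K)) euclidean f"
    using K by (intro continuous_map_eq[OF continuous_map_canonical_const[where c=0]]) auto
  moreover have "continuous_map (subtopology ?X W) euclidean f"
    using W fW by (simp add: subtopology_subtopology inf.absorb2)
  ultimately have "\<And>S. S \<in> {W, topspace ?X - K} \<Longrightarrow> openin ?X S"
    "\<And>S. S \<in> {W, topspace ?X - K} \<Longrightarrow> continuous_map (subtopology ?X S) euclidean f"
    by blast+
  then have "continuous_map ?X euclidean f"
    by (rule pasting_lemma[where T="\<lambda>S. S" and f="\<lambda>_. f"]) (use K(2) in blast)+
  then show ?thesis
    unfolding Cc_iff[OF V] using K W(2) by blast
qed

lemma continuous_map_times: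
  fixes f g :: "'a \<Rightarrow> 'b::real_normed_algebra"
  assumes "continuous_map X euclidean f" "continuous_map X euclidean g"
  shows "continuous_map X euclidean (\<lambda>x. f x * g x)"
  using assms by (simp add: continuous_map_atin tendsto_mult)

lemma Cc_mult:
  assumes "open_Hausdorff G V" "f \<in> Cc G V" "continuous_map (subtopology (gtop G) V) euclidean g"
  shows "(\<lambda>x. f x * g x) \<in> Cc G V"
proof -
  obtain K where "compactin (gtop G) K" "K \<subseteq> V" "\<And>x. x \<notin> K \<Longrightarrow> f x = 0"
    using assms by (auto simp: Cc_iff)
  moreover have "continuous_map (subtopology (gtop G) V) euclidean (\<lambda>x. f x * g x)"
    using assms CcD(1) by (blast intro: continuous_map_times)
  ultimately show ?thesis
    unfolding Cc_iff[OF assms(1)] by auto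
qed

lemma Cc_diff:
  assumes V: "open_Hausdorff G V" and f: "f \<in> Cc G V" "g \<in> Cc G V"
  shows "f - g \<in> Cc G V"
proof -
  obtain K L where "compactin (gtop G) K" "K \<subseteq> V" "\<And>x. x \<notin> K \<Longrightarrow> f x = 0"
    "compactin (gtop G) L" "L \<subseteq> V" "\<And>x. x \<notin> L \<Longrightarrow> g x = 0"
    using f V by (auto simp: Cc_iff)
  then have "\<exists>K. compactin (gtop G) K \<and> K \<subseteq> V \<and> (\<forall>x. x \<notin> K \<longrightarrow> (f - g) x = 0)"
    by (intro exI[of _ "K \<union> L"]) (auto intro: compactin_Un)
  moreover have "continuous_map (subtopology (gtop G) V) euclidean (f - g)"
    using CcD(1)[OF f(1)] CcD(1)[OF f(2)] unfolding fun_diff_def by (intro continuous_intros)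
  ultimately show ?thesis
    using V by (simp add: Cc_iff)
qed

lemma Cc_compose:
  assumes V: "open_Hausdorff G V" and f: "f \<in> Cc G V"
    and \<phi>: "continuous_on UNIV \<phi>" "\<phi> 0 = 0"
  shows "(\<lambda>x. \<phi> (f x)) \<in> Cc G V"
proof -
  have "continuous_map (subtopology (gtop G) V) euclidean (\<phi> \<circ> f)"
    using CcD(1)[OF f] \<phi> by (intro continuous_map_compose) auto
  then show ?thesis
    using f \<phi> unfolding Cc_iff[OF V] o_def by metis
qed

lemma Cc_transport:
  assumes U: "open_Hausdorff G U" and V: "open_Hausdorff G V" and f: "f \<in> Cc G U"
    and hom: "homeomorphic_maps (subtopology (gtop G) U) (subtopology (gtop G) V) h g"
  shows "(\<lambda>z. if z \<in> V then f (g z) else 0) \<in> Cc G V"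
proof -
  let ?X = "subtopology (gtop G) U" and ?Y = "subtopology (gtop G) V"
  have top: "topspace ?X = U" "topspace ?Y = V"
    using U V by (auto simp: open_Hausdorff_def dest: openin_subset)
  obtain K where K: "compactin ?X K" "K \<subseteq> U" "\<And>x. x \<notin> K \<Longrightarrow> f x = 0"
    using f U by (auto simp: Cc_iff compactin_subtopology)
  have h: "continuous_map ?X ?Y h" "continuous_map ?Y ?X g" "\<And>y. y \<in> V \<Longrightarrow> h (g y) = y"
    using hom top by (auto simp: homeomorphic_maps_def)
  have "compactin ?Y (h ` K)"
    using K h by (auto intro: image_compactin)
  moreover have "continuous_map ?Y euclidean (f \<circ> g)"
    using h CcD(1)[OF f] by (blast intro: continuous_map_compose)
  then have "continuous_map ?Y euclidean (\<lambda>z. if z \<in> V then f (g z) else 0)"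
    by (rule continuous_map_eq) (auto simp: top)
  moreover have "(if z \<in> V then f (g z) else 0) = 0" if "z \<notin> h ` K" for z
    using that h(3) K(3) by (metis image_eqI)
  ultimately show ?thesis
    unfolding Cc_iff[OF V] compactin_subtopology by blast
qed

lemma cmod_le_supnorm:
  assumes V: "open_Hausdorff G V" and f: "f \<in> Cc G V"
  shows "cmod (f x) \<le> supnorm f"
proof -
  obtain K where K: "compactin (subtopology (gtop G) V) K" "\<And>x. x \<notin> K \<Longrightarrow> f x = 0"
    using f V by (auto simp: Cc_iff compactin_subtopology)
  then have "compactin euclidean (f ` K)"
    using CcD(1)[OF f] by (blast intro: image_compactin)
  then have "bounded (f ` K)"
    by (auto intro: compact_imp_bounded)
  then obtain B where B: "\<And>x. x \<in> K \<Longrightarrow> cmod (f x) \<le> B"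
    by (auto simp: bounded_iff)
  have "cmod (f y) \<le> max B 0" for y
    using B[of y] K(2)[of y] by (cases "y \<in> K") auto
  then have "bdd_above (range (\<lambda>y. cmod (f y)))"
    by (rule bdd_aboveI2)
  then show ?thesis
    unfolding supnorm_def by (rule cSUP_upper[rotated]) simp
qed

lemma supnorm_least:
  assumes "\<And>x. cmod (f x) \<le> C"
  shows "supnorm f \<le> C"
  unfolding supnorm_def using assms by (intro cSUP_least) auto

section \<open>Bisections of etale groupoids\<close>

lemma local_homeomorphismE:
  assumes "local_homeomorphism X Y f" "x \<in> topspace X"
  obtains U where "openin X U" "x \<in> U" "openin Y (f ` U)"
    "homeomorphic_map (subtopology X U) (subtopology Y (f ` U)) f"
  using assms unfolding local_homeomorphism_def by metis

lemma local_homeomorphism_imp_continuous_map: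
  assumes "local_homeomorphism X Y f"
  shows "continuous_map X Y f"
proof (rule pasting_lemma[where f="\<lambda>_. f" and T="\<lambda>U. U"
      and I="{U. openin X U \<and> continuous_map (subtopology X U) Y f}"])
  fix x assume "x \<in> topspace X"
  then obtain U where "openin X U" "x \<in> U" "homeomorphic_map (subtopology X U) (subtopology Y (f ` U)) f"
    using local_homeomorphismE[OF assms] by metis
  moreover from this have "continuous_map (subtopology X U) Y f"
    by (intro continuous_map_into_fulltopology[OF homeomorphic_imp_continuous_map])
  ultimately show "\<exists>U. U \<in> {U. openin X U \<and> continuous_map (subtopology X U) Y f} \<and> x \<in> U \<and> f x = f x"
    by blast
qed auto

lemma local_homeomorphism_imp_open_map:
  assumes "local_homeomorphism X Y f"
  shows "open_map X Y f"
  unfolding open_map_def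
proof (intro allI impI)
  fix W assume W: "openin X W"
  have "\<exists>T. openin Y T \<and> f x \<in> T \<and> T \<subseteq> f ` W" if "x \<in> W" for x
  proof -
    have "x \<in> topspace X"
      using that W openin_subset by blast
    then obtain U where U: "openin X U" "x \<in> U" "openin Y (f ` U)"
      "homeomorphic_map (subtopology X U) (subtopology Y (f ` U)) f"
      using local_homeomorphismE[OF assms] by metis
    have "openin (subtopology Y (f ` U)) (f ` (W \<inter> U))"
      using homeomorphic_imp_open_map[OF U(4)] openin_subtopology_Int[OF W] by (simp add: open_map_def)
    then have "openin Y (f ` (W \<inter> U))"
      using U(3) by (rule openin_trans_full)
    then show ?thesis
      using that U by blast
  qed
  then show "openin Y (f ` W)"
    by (subst openin_subopen) blast
qed

context algebraic_groupoid
begin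

lemma unitsD:
  assumes "u \<in> units G"
  shows "u \<in> arrows G" "src G u = u" "rng G u = u"
  using assms src_in src_src rng_src by (auto simp: units_def)

lemma src_units: "x \<in> arrows G \<Longrightarrow> src G x \<in> units G"
  by (simp add: units_def)

lemma rng_units: "x \<in> arrows G \<Longrightarrow> rng G x \<in> units G"
  using src_units[of "rng G x"] rng_in src_rng by simp

lemma inv_inv:
  assumes x: "x \<in> arrows G"
  shows "ginv G (ginv G x) = x"
proof -
  let ?y = "ginv G x"
  have y: "?y \<in> arrows G" "ginv G ?y \<in> arrows G"
    using x inv_in by auto
  have "ginv G ?y = gmul G (ginv G ?y) (src G (ginv G ?y))"
    using y by (simp add: mul_src)
  also have "\<dots> = gmul G (ginv G ?y) (gmul G ?y x)"
    using x y by (simp add: src_inv rng_inv inv_mul)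
  also have "\<dots> = gmul G (gmul G (ginv G ?y) ?y) x"
    using x y by (intro mul_assoc[symmetric]) (auto simp: composable_def src_inv rng_inv)
  also have "\<dots> = gmul G (rng G x) x"
    using x y by (simp add: inv_mul src_inv)
  finally show ?thesis
    using x by (simp add: rng_mul_self)
qed

lemma inv_unit:
  assumes "u \<in> units G"
  shows "ginv G u = u"
  using mul_src[of "ginv G u"] inv_mul[of u] inv_in[of u] src_inv[of u] unitsD[OF assms] by simp

end

lemma bisectionD:
  assumes "bisection G U"
  shows "openin (gtop G) U" "inj_on (src G) U" "inj_on (rng G) U" "U \<subseteq> arrows G"
  using assms by (auto simp: bisection_def arrows_def dest: openin_subset)

context etale_groupoid
begin

lemma continuous_rng: "continuous_map (gtop G) (gtop G) (rng G)"
  using local_homeomorphism_imp_continuous_map[OF local_homeomorphism_rng]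
  unfolding unit_space_def by (rule continuous_map_into_fulltopology)

text \<open>Where \<open>rng\<close> is injective on an open \<open>U\<close> around a unit, an arrow \<open>x\<close> of \<open>U\<close> whose range is again in
  \<open>U\<close> must equal its range, because \<open>x\<close> and \<open>rng x\<close> have the same range.\<close>
lemma openin_units: "openin (gtop G) (units G)"
proof (subst openin_subopen, intro ballI)
  fix u assume u: "u \<in> units G"
  then have "u \<in> topspace (gtop G)"
    using unitsD(1)[OF u] by (simp add: arrows_def)
  then obtain U where U: "openin (gtop G) U" "u \<in> U"
    "homeomorphic_map (subtopology (gtop G) U) (subtopology (unit_space G) (rng G ` U)) (rng G)"
    using local_homeomorphismE[OF local_homeomorphism_rng] by metis
  have top: "topspace (subtopology (gtop G) U) = U"
    using U(1) by (auto dest: openin_subset)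
  have inj: "inj_on (rng G) U"
    using homeomorphic_imp_injective_map[OF U(3)] top by simp
  let ?T = "U \<inter> {x \<in> topspace (gtop G). rng G x \<in> U}"
  have "openin (gtop G) ?T"
    using U(1) continuous_rng by (intro openin_Int openin_continuous_map_preimage)
  moreover have "u \<in> ?T"
    using U(2) u unitsD[OF u] by (simp add: arrows_def)
  moreover have "?T \<subseteq> units G"
  proof clarify
    fix x assume x: "x \<in> U" "x \<in> topspace (gtop G)" "rng G x \<in> U"
    then have "rng G x = x"
      using inj rng_rng[of x] by (auto simp: inj_on_def arrows_def)
    then show "x \<in> units G"
      using rng_units[of x] x by (simp add: arrows_def)
  qed
  ultimately show "\<exists>T. openin (gtop G) T \<and> u \<in> T \<and> T \<subseteq> units G"
    by blast
qed

lemma bisection_units: "bisection G (units G)"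
  using openin_units unitsD by (auto simp: bisection_def inj_on_def)

text \<open>Bisections inherit the separation and local compactness of the unit space through the source map,
  although the whole groupoid need not be Hausdorff.\<close>
lemma bisection_src_homeomorphic:
  assumes U: "bisection G U"
  shows "homeomorphic_map (subtopology (gtop G) U) (subtopology (unit_space G) (src G ` U)) (src G)"
    and "openin (unit_space G) (src G ` U)"
proof -
  have o: "open_map (gtop G) (unit_space G) (src G)"
    by (rule local_homeomorphism_imp_open_map[OF local_homeomorphism_src])
  then show *: "openin (unit_space G) (src G ` U)"
    using bisectionD(1)[OF U] by (simp add: open_map_def)
  have top: "topspace (subtopology (gtop G) U) = U"
    using bisectionD(1)[OF U] by (auto dest: openin_subset)
  have "continuous_map (subtopology (gtop G) U) (unit_space G) (src G)"
    using local_homeomorphism_imp_continuous_map[OF local_homeomorphism_src]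
    by (rule continuous_map_from_subtopology)
  moreover have "open_map (subtopology (gtop G) U) (unit_space G) (src G)"
    using o bisectionD(1)[OF U] by (rule open_map_from_subtopology)
  moreover have "inj_on (src G) (topspace (subtopology (gtop G) U))"
    using bisectionD(2)[OF U] top by simp
  ultimately have "embedding_map (subtopology (gtop G) U) (unit_space G) (src G)"
    by (rule injective_open_imp_embedding_map)
  then show "homeomorphic_map (subtopology (gtop G) U) (subtopology (unit_space G) (src G ` U)) (src G)"
    unfolding embedding_map_def top .
qed

lemma bisection_open_Hausdorff:
  assumes U: "bisection G U"
  shows "open_Hausdorff G U"
  using homeomorphic_map_imp_homeomorphic_space[OF bisection_src_homeomorphic(1)[OF U]]
    Hausdorff_space_subtopology[OF Hausdorff_unit_space] bisectionD(1)[OF U]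
  by (auto simp: open_Hausdorff_def homeomorphic_Hausdorff_space)

lemma bisection_locally_compact:
  assumes U: "bisection G U"
  shows "locally_compact_space (subtopology (gtop G) U)"
  using homeomorphic_map_imp_homeomorphic_space[OF bisection_src_homeomorphic(1)[OF U]]
    locally_compact_space_open_subset[OF _ locally_compact_unit_space bisection_src_homeomorphic(2)[OF U]]
    Hausdorff_unit_space
  by (auto simp: homeomorphic_locally_compact_space)

lemma exists_bisection:
  assumes V: "openin (gtop G) V" and x: "x \<in> V"
  obtains U where "bisection G U" "x \<in> U" "U \<subseteq> V"
proof -
  have inj: "\<exists>U. openin (gtop G) U \<and> x \<in> U \<and> inj_on f U"
    if f: "local_homeomorphism (gtop G) (unit_space G) f" for f
  proof -
    have "x \<in> topspace (gtop G)"
      using V x by (auto dest: openin_subset)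
    then obtain U where U: "openin (gtop G) U" "x \<in> U"
      "homeomorphic_map (subtopology (gtop G) U) (subtopology (unit_space G) (f ` U)) f"
      using local_homeomorphismE[OF f] by metis
    have "topspace (subtopology (gtop G) U) = U"
      using U(1) by (auto dest: openin_subset)
    then show ?thesis
      using U(1,2) homeomorphic_imp_injective_map[OF U(3)] by metis
  qed
  obtain A B where "openin (gtop G) A" "x \<in> A" "inj_on (src G) A"
    "openin (gtop G) B" "x \<in> B" "inj_on (rng G) B"
    using inj[OF local_homeomorphism_src] inj[OF local_homeomorphism_rng] by blast
  then have "bisection G (A \<inter> B \<inter> V)" "x \<in> A \<inter> B \<inter> V"
    using V x by (auto simp: bisection_def intro: inj_on_subset)
  then show thesis
    using that by blast
qed

text \<open>Urysohn's lemma is applied inside the locally compact Hausdorff set \<open>U\<close>; extended by \<open>0\<close>, the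
  function may fail to be continuous on the whole groupoid.\<close>
lemma bump_function:
  assumes U: "bisection G U" and K: "compactin (gtop G) K" "K \<subseteq> U"
  obtains \<kappa> :: "'a \<Rightarrow> real" where "(\<lambda>x. complex_of_real (\<kappa> x)) \<in> Cc G U"
    "\<And>x. 0 \<le> \<kappa> x" "\<And>x. \<kappa> x \<le> 1" "\<And>x. x \<in> K \<Longrightarrow> \<kappa> x = 1"
proof -
  let ?X = "subtopology (gtop G) U"
  have H: "Hausdorff_space ?X" and lc: "locally_compact_space ?X" and top: "topspace ?X = U"
    using bisection_open_Hausdorff[OF U] bisection_locally_compact[OF U]
    by (auto simp: open_Hausdorff_def dest: openin_subset)
  have KX: "compactin ?X K"
    using K by (simp add: compactin_subtopology)
  obtain W L where W: "openin ?X W" and L: "compactin ?X L" and WL: "K \<subseteq> W" "W \<subseteq> L"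
    using lc KX locally_compact_space_compact_closed_compact[of ?X] H by blast
  have "completely_regular_space ?X"
    using lc H locally_compact_Hausdorff_imp_regular_space
      locally_compact_regular_imp_completely_regular_space by blast
  moreover have "closedin ?X (U - W)"
    using W top by (metis closedin_diff closedin_topspace)
  moreover have "disjnt K (U - W)"
    using WL by (auto simp: disjnt_def)
  ultimately obtain f where f: "continuous_map ?X (top_of_set {0..1::real}) f"
    "f ` (U - W) \<subseteq> {0}" "f ` K \<subseteq> {1}"
    using KX by (rule_tac Urysohn_completely_regular_compact_closed[of 0 1 ?X K "U - W"]) auto
  define \<kappa> where "\<kappa> x = (if x \<in> U then f x else 0)" for x
  have f01: "f x \<in> {0..1}" if "x \<in> U" for x
    using f(1) that top by (auto simp: continuous_map_in_subtopology)
  have "continuous_map ?X euclidean (complex_of_real \<circ> f)"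
    using f(1) by (intro continuous_map_compose[of _ euclidean])
      (auto simp: continuous_map_in_subtopology intro: continuous_intros)
  then have "continuous_map ?X euclidean (\<lambda>x. complex_of_real (\<kappa> x))"
    by (rule continuous_map_eq) (auto simp: \<kappa>_def top)
  moreover have "complex_of_real (\<kappa> x) = 0" if "x \<notin> L" for x
    using that f(2) WL by (auto simp: \<kappa>_def)
  moreover have "compactin (gtop G) L \<and> L \<subseteq> U"
    using L by (simp add: compactin_subtopology)
  ultimately have "(\<lambda>x. complex_of_real (\<kappa> x)) \<in> Cc G U"
    unfolding Cc_iff[OF bisection_open_Hausdorff[OF U]] by blast
  then show thesis
    by (rule that) (use f01 f(3) K in \<open>auto simp: \<kappa>_def\<close>)
qed

end

section \<open>Convolution and involution\<close>

text \<open>For a bisection \<open>U\<close> this is \<open>f \<circ> (src|\<^sub>U)\<^sup>-\<^sup>1\<close> on \<open>src(U)\<close>, extended by \<open>0\<close>.\<close>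
definition src_pushforward :: "'g groupoid \<Rightarrow> 'g set \<Rightarrow> ('g \<Rightarrow> complex) \<Rightarrow> 'g \<Rightarrow> complex" where
  "src_pushforward G U f = (\<lambda>z. if z \<in> src G ` U then f (inv_into U (src G) z) else 0)"

lemma src_pushforward_src:
  "bisection G U \<Longrightarrow> x \<in> U \<Longrightarrow> src_pushforward G U f (src G x) = f x"
  using bisectionD(2)[of G U] by (simp add: src_pushforward_def)

lemma src_pushforward_outside: "z \<notin> src G ` U \<Longrightarrow> src_pushforward G U f z = 0"
  by (simp add: src_pushforward_def)

lemma star_add: "star G (f + g) = star G f + star G g"
  by (auto simp: star_def)

lemma star_fscale: "star G (fscale c f) = fscale (cnj c) (star G f)"
  by (auto simp: star_def fscale_def)

context algebraic_groupoid
begin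

lemma star_units:
  assumes f: "f \<in> Cc G (units G)"
  shows "star G f = (\<lambda>x. cnj (f x))"
proof
  fix x
  have unit: "x \<in> units G" if "x \<in> arrows G" "ginv G x \<in> units G"
    using that inv_unit inv_inv by metis
  show "star G f x = cnj (f x)"
    using CcD(2)[OF f, of x] CcD(2)[OF f, of "ginv G x"] unit unitsD(1)[of x] inv_unit[of x]
    by (cases "x \<in> units G") (auto simp: star_def)
qed

lemma conv_unit_right:
  assumes p: "\<And>x. x \<notin> arrows G \<Longrightarrow> p x = 0" and g: "\<And>x. x \<notin> units G \<Longrightarrow> g x = 0"
  shows "conv G p g = (\<lambda>z. p z * g (src G z))"
proof
  fix z
  let ?A = "{(x, y) \<in> composable G. gmul G x y = z \<and> p x * g y \<noteq> 0}"
  have "(x, y) \<in> ?A \<longleftrightarrow> x = z \<and> y = src G z \<and> p z * g (src G z) \<noteq> 0" for x y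
  proof
    assume "(x, y) \<in> ?A"
    then have xy: "x \<in> arrows G" "src G x = rng G y" "gmul G x y = z" "p x \<noteq> 0" "g y \<noteq> 0"
      by (auto simp: composable_def)
    then have "src G x = y"
      using g[of y] unitsD(3)[of y] by auto
    then show "x = z \<and> y = src G z \<and> p z * g (src G z) \<noteq> 0"
      using xy mul_src[of x] by auto
  next
    assume z: "x = z \<and> y = src G z \<and> p z * g (src G z) \<noteq> 0"
    then have "z \<in> arrows G"
      using p[of z] by auto
    then show "(x, y) \<in> ?A"
      using z by (auto simp: composable_def src_in rng_src mul_src)
  qed
  then have "?A = (if p z * g (src G z) = 0 then {} else {(z, src G z)})"
    by auto
  then show "conv G p g z = p z * g (src G z)"
    by (auto simp: conv_def)
qed

lemma conv_unit_left:
  assumes p: "\<And>x. x \<notin> arrows G \<Longrightarrow> p x = 0" and g: "\<And>x. x \<notin> units G \<Longrightarrow> g x = 0"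
  shows "conv G g p = (\<lambda>z. g (rng G z) * p z)"
proof
  fix z
  let ?A = "{(x, y) \<in> composable G. gmul G x y = z \<and> g x * p y \<noteq> 0}"
  have "(x, y) \<in> ?A \<longleftrightarrow> x = rng G z \<and> y = z \<and> g (rng G z) * p z \<noteq> 0" for x y
  proof
    assume "(x, y) \<in> ?A"
    then have xy: "y \<in> arrows G" "src G x = rng G y" "gmul G x y = z" "g x \<noteq> 0" "p y \<noteq> 0"
      by (auto simp: composable_def)
    then have "rng G y = x"
      using g[of x] unitsD(2)[of x] by auto
    then show "x = rng G z \<and> y = z \<and> g (rng G z) * p z \<noteq> 0"
      using xy rng_mul_self[of y] by auto
  next
    assume z: "x = rng G z \<and> y = z \<and> g (rng G z) * p z \<noteq> 0"
    then have "z \<in> arrows G"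
      using p[of z] by auto
    then show "(x, y) \<in> ?A"
      using z by (auto simp: composable_def rng_in src_rng rng_mul_self)
  qed
  then have "?A = (if g (rng G z) * p z = 0 then {} else {(rng G z, z)})"
    by auto
  then show "conv G g p z = g (rng G z) * p z"
    by (auto simp: conv_def)
qed

text \<open>A product \<open>x y\<close> that contributes has \<open>x\<^sup>-\<^sup>1\<close> and \<open>y\<close> in \<open>U\<close> with equal range, so \<open>x = y\<^sup>-\<^sup>1\<close> and the
  product is the unit \<open>src y\<close>. Convolution after a star therefore becomes pointwise multiplication,
  read on the unit space.\<close>
lemma conv_star_bisection:
  assumes U: "bisection G U" and p: "\<And>x. x \<notin> U \<Longrightarrow> p x = 0" and q: "\<And>x. x \<notin> U \<Longrightarrow> q x = 0"
  shows "conv G (star G p) q = src_pushforward G U (\<lambda>x. cnj (p x) * q x)"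
proof
  fix z
  let ?A = "{(x, y) \<in> composable G. gmul G x y = z \<and> star G p x * q y \<noteq> 0}"
  have A: "x = ginv G y \<and> y \<in> U \<and> z = src G y" if "(x, y) \<in> ?A" for x y
  proof -
    have xy: "x \<in> arrows G" "y \<in> arrows G" "src G x = rng G y" "gmul G x y = z"
      "ginv G x \<in> U" "y \<in> U"
      using that p q by (auto simp: composable_def star_def split: if_splits)
    then have "ginv G x = y"
      using bisectionD(3)[OF U] rng_inv by (auto simp: inj_on_def)
    then have "x = ginv G y"
      using inv_inv[OF xy(1)] by simp
    then show ?thesis
      using xy inv_mul by simp
  qed
  show "conv G (star G p) q z = src_pushforward G U (\<lambda>x. cnj (p x) * q x) z"
  proof (cases "z \<in> src G ` U")
    case True
    then obtain y where y: "y \<in> U" "z = src G y" by blast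
    have ya: "y \<in> arrows G"
      using bisectionD(4)[OF U] y by blast
    have "?A \<subseteq> {(ginv G y, y)}"
    proof (rule subrelI)
      fix a b assume "(a, b) \<in> ?A"
      then have ab: "a = ginv G b \<and> b \<in> U \<and> z = src G b"
        by (rule A)
      then have "b = y"
        using y inj_onD[OF bisectionD(2)[OF U], of b y] by simp
      then show "(a, b) \<in> {(ginv G y, y)}"
        using ab by simp
    qed
    moreover have "(ginv G y, y) \<in> composable G" "gmul G (ginv G y) y = z"
      using ya y by (auto simp: composable_def inv_in src_inv inv_mul)
    ultimately have "conv G (star G p) q z = (\<Sum>(x, y) \<in> {(ginv G y, y)}. star G p x * q y)"
      unfolding conv_def by (intro sum.mono_neutral_left) auto
    also have "\<dots> = cnj (p y) * q y"
      using ya inv_in inv_inv by (simp add: star_def)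
    finally show ?thesis
      using y src_pushforward_src[OF U] by simp
  next
    case False
    then have "?A = {}"
      using A by blast
    then have "conv G (star G p) q z = 0"
      unfolding conv_def by (metis sum.empty)
    then show ?thesis
      using False by (simp add: src_pushforward_outside)
  qed
qed

end

context etale_groupoid
begin

lemma src_pushforward_Cc:
  assumes U: "bisection G U" and f: "f \<in> Cc G U"
  shows "src_pushforward G U f \<in> Cc G (units G)"
proof -
  let ?V = "src G ` U"
  have sub: "?V \<subseteq> units G"
    using bisectionD(4)[OF U] by (auto simp: units_def)
  have "subtopology (unit_space G) ?V = subtopology (gtop G) ?V"
    using sub by (simp add: unit_space_def subtopology_subtopology inf.absorb2)
  then have hom: "homeomorphic_map (subtopology (gtop G) U) (subtopology (gtop G) ?V) (src G)"
    using bisection_src_homeomorphic(1)[OF U] by simp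
  have V: "openin (gtop G) ?V"
    using bisection_src_homeomorphic(2)[OF U] openin_units
    unfolding unit_space_def by (rule openin_trans_full)
  have units: "open_Hausdorff G (units G)"
    by (rule bisection_open_Hausdorff[OF bisection_units])
  have top: "topspace (subtopology (gtop G) U) = U" "topspace (subtopology (gtop G) ?V) = ?V"
    using openin_subset[OF V] openin_subset[OF bisectionD(1)[OF U]] by auto
  obtain g where g: "homeomorphic_maps (subtopology (gtop G) U) (subtopology (gtop G) ?V) (src G) g"
    using hom by (auto simp: homeomorphic_map_maps)
  have "src_pushforward G U f = (\<lambda>z. if z \<in> ?V then f (g z) else 0)"
  proof
    fix z
    show "src_pushforward G U f z = (if z \<in> ?V then f (g z) else 0)"
      using g bisectionD(2)[OF U] unfolding homeomorphic_maps_def top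
      by (auto simp: src_pushforward_def)
  qed
  also have "\<dots> \<in> Cc G ?V"
    using bisection_open_Hausdorff[OF U] open_Hausdorff_subset[OF units V sub] f g by (rule Cc_transport)
  finally show ?thesis
    using units V sub by (rule Cc_extend)
qed

lemma bisection_inverse:
  assumes U: "bisection G U"
  shows "bisection G (ginv G ` U)"
    and "homeomorphic_maps (subtopology (gtop G) U) (subtopology (gtop G) (ginv G ` U)) (ginv G) (ginv G)"
proof -
  have maps: "homeomorphic_maps (gtop G) (gtop G) (ginv G) (ginv G)"
    using continuous_inv inv_inv by (auto simp: homeomorphic_maps_def arrows_def)
  have sub: "U \<subseteq> topspace (gtop G)" and arr: "\<And>x. x \<in> U \<Longrightarrow> x \<in> arrows G"
    using bisectionD(4)[OF U] by (auto simp: arrows_def)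
  have im: "ginv G ` U \<subseteq> topspace (gtop G)"
    using arr inv_in by (auto simp: arrows_def)
  show "homeomorphic_maps (subtopology (gtop G) U) (subtopology (gtop G) (ginv G ` U)) (ginv G) (ginv G)"
    using maps sub im by (intro homeomorphic_maps_subtopologies) (auto simp: Int_absorb1)
  have "openin (gtop G) (ginv G ` U)"
    using homeomorphic_map_openness[of "gtop G" "gtop G" "ginv G" U] maps sub bisectionD(1)[OF U]
    by (auto simp: homeomorphic_map_maps)
  then show "bisection G (ginv G ` U)"
    using bisectionD(2,3)[OF U] arr by (auto simp: bisection_def inj_on_def src_inv rng_inv)
qed

lemma star_Cc:
  assumes U: "bisection G U" and f: "f \<in> Cc G U"
  shows "star G f \<in> Cc G (ginv G ` U)"
proof -
  let ?V = "ginv G ` U"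
  have V: "open_Hausdorff G ?V"
    by (rule bisection_open_Hausdorff[OF bisection_inverse(1)[OF U]])
  have "(\<lambda>z. if z \<in> ?V then f (ginv G z) else 0) \<in> Cc G ?V"
    using bisection_open_Hausdorff[OF U] V f bisection_inverse(2)[OF U] by (rule Cc_transport)
  then have "(\<lambda>z. cnj (if z \<in> ?V then f (ginv G z) else 0)) \<in> Cc G ?V"
    using V by (intro Cc_compose[where \<phi>=cnj]) (auto intro: continuous_intros)
  also have "(\<lambda>z. cnj (if z \<in> ?V then f (ginv G z) else 0)) = star G f"
  proof
    fix z
    have "z \<in> arrows G" if "z \<in> ?V"
      using that bisectionD(4)[OF bisection_inverse(1)[OF U]] by blast
    moreover have "f (ginv G z) = 0" if "z \<in> arrows G" "z \<notin> ?V"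
      using CcD(2)[OF f, of "ginv G z"] that inv_inv[of z] by (metis image_eqI)
    ultimately show "cnj (if z \<in> ?V then f (ginv G z) else 0) = star G f z"
      by (auto simp: star_def)
  qed
  finally show ?thesis .
qed

end

section \<open>Decomposition into functions on bisections\<close>

interpretation fscale: Modules.module fscale
  by unfold_locales (auto simp: fscale_def fun_eq_iff algebra_simps)

lemma Cc_subset_A0: "open_Hausdorff G V \<Longrightarrow> f \<in> Cc G V \<Longrightarrow> f \<in> A0 G"
  unfolding A0_def by (rule fscale.span_base) blast

context etale_groupoid
begin

lemma Cc_bisection_A0: "bisection G U \<Longrightarrow> f \<in> Cc G U \<Longrightarrow> f \<in> A0 G"
  using bisection_open_Hausdorff by (rule Cc_subset_A0)

text \<open>Cover the support of \<open>f\<close> by finitely many sets on each of which some bump function \<open>b\<close> supported in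
  a bisection is \<open>1\<close>. Splitting \<open>f = b f + (f - b f)\<close> for one bump function after another leaves in
  the end the product of \<open>f\<close> with all factors \<open>1 - b\<close>, which is \<open>0\<close>. Unlike a partition of unity, this
  needs no division.\<close>
lemma Cc_span_bisections:
  assumes V: "open_Hausdorff G V" and f: "f \<in> Cc G V"
  shows "f \<in> fscale.span (\<Union>U \<in> Collect (bisection G). Cc G U)"
proof -
  let ?S = "fscale.span (\<Union>U \<in> Collect (bisection G). Cc G U)"
  define bumps where "bumps = {b. \<exists>U. bisection G U \<and> U \<subseteq> V \<and> b \<in> Cc G U}"
  \<comment> \<open>The function is generalised here because the induction replaces it by what remains of it.\<close>
  have cut: "f \<in> ?S" if "finite F" "F \<subseteq> bumps" "f \<in> Cc G V" "\<And>x. f x \<noteq> 0 \<Longrightarrow> \<exists>b\<in>F. b x = 1" for F f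
    using that
  proof (induction F arbitrary: f)
    case empty
    then have "f = 0"
      by (auto simp: fun_eq_iff)
    then show ?case
      by (metis fscale.span_zero)
  next
    case (insert b F)
    obtain U where U: "bisection G U" "U \<subseteq> V" "b \<in> Cc G U"
      using insert.prems by (auto simp: bumps_def)
    have "continuous_map (subtopology (gtop G) U) euclidean f"
      using CcD(1)[OF insert.prems(2)] U(2) by (rule continuous_map_from_subtopology_mono)
    then have bf: "(\<lambda>x. b x * f x) \<in> Cc G U"
      using U bisection_open_Hausdorff by (intro Cc_mult) auto
    then have "(\<lambda>x. b x * f x) \<in> Cc G V"
      using V bisectionD(1)[OF U(1)] U(2) by (rule Cc_extend)
    then have rest: "f - (\<lambda>x. b x * f x) \<in> Cc G V"
      using insert.prems(2) by (intro Cc_diff V)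
    have "\<exists>b\<in>F. b x = 1" if "(f - (\<lambda>x. b x * f x)) x \<noteq> 0" for x
      using that insert.prems(3)[of x] by auto
    then have "f - (\<lambda>x. b x * f x) \<in> ?S"
      using insert.IH[OF _ rest] insert.prems(1) by blast
    moreover have "(\<lambda>x. b x * f x) \<in> ?S"
      using bf U(1) by (intro fscale.span_base) blast
    ultimately have "(f - (\<lambda>x. b x * f x)) + (\<lambda>x. b x * f x) \<in> ?S"
      by (rule fscale.span_add)
    then show ?case
      by simp
  qed
  obtain K where K: "compactin (gtop G) K" "K \<subseteq> V" "\<And>x. x \<notin> K \<Longrightarrow> f x = 0"
    using f V by (auto simp: Cc_iff)
  define cover where "cover = {N. openin (gtop G) N \<and> (\<exists>b\<in>bumps. \<forall>x\<in>N. b x = 1)}"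
  have "\<exists>N\<in>cover. x \<in> N" if x: "x \<in> K" for x
  proof -
    obtain U where U: "bisection G U" "x \<in> U" "U \<subseteq> V"
      using exists_bisection[of V x] V K(2) x unfolding open_Hausdorff_def by blast
    then have "x \<in> topspace (subtopology (gtop G) U)"
      using bisectionD(4)[OF U(1)] by (auto simp: arrows_def)
    then obtain N L where N: "openin (subtopology (gtop G) U) N" "x \<in> N" "N \<subseteq> L"
      and L: "compactin (subtopology (gtop G) U) L"
      using bisection_locally_compact[OF U(1)] unfolding locally_compact_space_def by metis
    obtain \<kappa> where \<kappa>: "(\<lambda>x. complex_of_real (\<kappa> x)) \<in> Cc G U" "\<And>x. x \<in> L \<Longrightarrow> \<kappa> x = 1"
      using bump_function[OF U(1)] L unfolding compactin_subtopology by metis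
    have "(\<lambda>x. complex_of_real (\<kappa> x)) \<in> bumps"
      using \<kappa>(1) U by (auto simp: bumps_def)
    moreover have "openin (gtop G) N"
      using N(1) bisectionD(1)[OF U(1)] by (rule openin_trans_full)
    ultimately have "N \<in> cover"
      using \<kappa>(2) N(3) unfolding cover_def by (auto intro!: bexI[of _ "\<lambda>x. complex_of_real (\<kappa> x)"])
    then show ?thesis
      using N(2) by blast
  qed
  then have "K \<subseteq> \<Union>cover"
    by blast
  moreover have "\<And>N. N \<in> cover \<Longrightarrow> openin (gtop G) N"
    by (simp add: cover_def)
  ultimately obtain F where F: "finite F" "F \<subseteq> cover" "K \<subseteq> \<Union>F"
    using compactinD[OF K(1)] by metis
  have "\<forall>N\<in>F. \<exists>b. b \<in> bumps \<and> (\<forall>x\<in>N. b x = 1)"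
    using F(2) by (auto simp: cover_def)
  then obtain \<beta> where \<beta>: "\<And>N. N \<in> F \<Longrightarrow> \<beta> N \<in> bumps" "\<And>N x. N \<in> F \<Longrightarrow> x \<in> N \<Longrightarrow> \<beta> N x = 1"
    by metis
  show ?thesis
  proof (rule cut)
    show "finite (\<beta> ` F)" "\<beta> ` F \<subseteq> bumps" "f \<in> Cc G V"
      using F \<beta> f by auto
    show "\<exists>b\<in>\<beta> ` F. b x = 1" if "f x \<noteq> 0" for x
      using that K(3) F(3) \<beta>(2) by blast
  qed
qed

lemma A0_eq_span_bisections: "A0 G = fscale.span (\<Union>U \<in> Collect (bisection G). Cc G U)"
proof
  show "A0 G \<subseteq> fscale.span (\<Union>U \<in> Collect (bisection G). Cc G U)"
    unfolding A0_def using Cc_span_bisections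
    by (intro fscale.span_minimal fscale.subspace_span) blast
  show "fscale.span (\<Union>U \<in> Collect (bisection G). Cc G U) \<subseteq> A0 G"
    unfolding A0_def using bisection_open_Hausdorff by (intro fscale.span_mono) blast
qed

end

section \<open>Representations and adjoints\<close>

lemma algebra_homD:
  assumes "algebra_hom G H \<pi>" "f \<in> A0 G"
  shows "\<pi> f \<in> bounded_operators H"
    and "\<xi> \<in> carrier H \<Longrightarrow> \<pi> f \<xi> \<in> carrier H"
    and "g \<in> A0 G \<Longrightarrow> \<xi> \<in> carrier H \<Longrightarrow> \<pi> (f + g) \<xi> = \<pi> f \<xi> \<oplus>\<^bsub>H\<^esub> \<pi> g \<xi>"
    and "\<xi> \<in> carrier H \<Longrightarrow> \<pi> (fscale c f) \<xi> = c \<odot>\<^bsub>H\<^esub> \<pi> f \<xi>"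
    and "g \<in> A0 G \<Longrightarrow> \<xi> \<in> carrier H \<Longrightarrow> \<pi> (conv G f g) \<xi> = \<pi> f (\<pi> g \<xi>)"
  using assms by (auto simp: algebra_hom_def bounded_operators_def)

context etale_groupoid
begin

lemma representation_contraction:
  assumes H: "inner_product_space H" and rep: "representation G H \<pi>"
    and U: "bisection G U" and k: "k \<in> Cc G U" "\<And>x. cmod (k x) \<le> 1" and \<xi>: "\<xi> \<in> carrier H"
  shows "hnorm H (\<pi> k \<xi>) \<le> hnorm H \<xi>"
proof -
  interpret inner_product_space H by (fact H)
  have "\<pi> k \<in> bounded_operators H"
    using rep algebra_homD(1) Cc_bisection_A0[OF U k(1)] by (auto simp: representation_def)
  then have "hnorm H (\<pi> k \<xi>) \<le> opnorm H (\<pi> k) * hnorm H \<xi>"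
    using \<xi> by (rule hnorm_le_opnorm)
  also have "opnorm H (\<pi> k) \<le> 1"
    using rep U k(1) supnorm_least[of k 1] k(2) by (fastforce simp: representation_def)
  then have "opnorm H (\<pi> k) * hnorm H \<xi> \<le> 1 * hnorm H \<xi>"
    using hnorm_nonneg[OF \<xi>] by (rule mult_right_mono)
  finally show ?thesis
    by simp
qed

text \<open>The contractions \<open>\<pi>(k)\<close> and \<open>\<pi>(k\<^sup>*)\<close> invert each other between the ranges of \<open>\<pi>(g)\<close> and \<open>\<pi>(f)\<close>. On
  an inner product space this forces the adjoint of \<open>\<pi>(k\<^sup>*)\<close> to agree with \<open>\<pi>(k)\<close> on the range of
  \<open>\<pi>(g)\<close>, so that the norm condition on representations produces the adjoint relation.\<close>
lemma representation_adjoint_bisection: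
  assumes H: "inner_product_space H" and rep: "representation G H \<pi>"
    and U: "bisection G U" and f: "f \<in> Cc G U"
  shows "is_adjoint H (\<pi> f) (\<pi> (star G f))"
  unfolding is_adjoint_def
proof (intro ballI)
  fix \<eta> \<zeta> assume \<eta>: "\<eta> \<in> carrier H" and \<zeta>: "\<zeta> \<in> carrier H"
  interpret inner_product_space H by (fact H)
  have hom: "algebra_hom G H \<pi>"
    using rep by (simp add: representation_def)
  have f0: "f x = 0" if "x \<notin> U" for x
    using that CcD(2)[OF f] by blast
  obtain K where K: "compactin (gtop G) K" "K \<subseteq> U" "\<And>x. x \<notin> K \<Longrightarrow> f x = 0"
    using f Cc_iff[OF bisection_open_Hausdorff[OF U]] by blast
  obtain \<kappa> where \<kappa>: "(\<lambda>x. complex_of_real (\<kappa> x)) \<in> Cc G U" "\<And>x. 0 \<le> \<kappa> x" "\<And>x. \<kappa> x \<le> 1"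
    "\<And>x. x \<in> K \<Longrightarrow> \<kappa> x = 1"
    using bump_function[OF U K(1,2)] by metis
  define k where "k = (\<lambda>x. complex_of_real (\<kappa> x))"
  have k: "k \<in> Cc G U" "\<And>x. cmod (k x) \<le> 1" "\<And>x. x \<notin> U \<Longrightarrow> k x = 0"
    using \<kappa> CcD(2)[OF \<kappa>(1)] by (auto simp: k_def)
  have kf: "cnj (k x) * f x = f x" "k x * f x = f x" for x
    using K(3)[of x] \<kappa>(4)[of x] by (cases "x \<in> K"; simp add: k_def)+
  define g where "g = src_pushforward G U f"
  have g: "g \<in> Cc G (units G)"
    unfolding g_def using U f by (rule src_pushforward_Cc)
  have g_src: "k x * g (src G x) = f x" for x
    using src_pushforward_src[OF U, of x f] k(3)[of x] f0[of x] kf(2)[of x]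
    by (cases "x \<in> U") (auto simp: g_def)
  have cg: "(\<lambda>x. cnj (g x)) \<in> Cc G (units G)"
    using g bisection_open_Hausdorff[OF bisection_units]
    by (intro Cc_compose[where \<phi>=cnj]) (auto intro: continuous_intros)
  have V: "bisection G (ginv G ` U)" and sk: "star G k \<in> Cc G (ginv G ` U)"
    using bisection_inverse(1)[OF U] star_Cc[OF U k(1)] by auto
  have sk1: "cmod (star G k x) \<le> 1" for x
    using k(2) by (simp add: star_def)
  have A0: "f \<in> A0 G" "k \<in> A0 G" "star G k \<in> A0 G" "g \<in> A0 G" "(\<lambda>x. cnj (g x)) \<in> A0 G"
    using f k sk g cg U V bisection_units Cc_bisection_A0 by blast+
  have arr: "x \<notin> arrows G \<Longrightarrow> k x = 0" "x \<notin> arrows G \<Longrightarrow> star G k x = 0" for x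
    using k(3)[of x] bisectionD(4)[OF U] by (auto simp: star_def)
  have "conv G k g = f"
    using conv_unit_right[of k g] arr(1) CcD(2)[OF g] g_src by (simp add: fun_eq_iff)
  then have fkg: "\<pi> f \<eta> = \<pi> k (\<pi> g \<eta>)"
    using algebra_homD(5)[OF hom A0(2,4) \<eta>] by simp
  have "conv G (star G k) f = g"
    using conv_star_bisection[OF U, of k f] k(3) f0 kf(1) by (simp add: g_def)
  then have gkf: "\<pi> g \<eta> = \<pi> (star G k) (\<pi> f \<eta>)"
    using algebra_homD(5)[OF hom A0(3,1) \<eta>] by simp
  have "conv G (\<lambda>x. cnj (g x)) (star G k) = star G f"
  proof
    fix z
    have "conv G (\<lambda>x. cnj (g x)) (star G k) z = cnj (g (rng G z)) * star G k z"
      using conv_unit_left[of "star G k" "\<lambda>x. cnj (g x)"] arr(2) CcD(2)[OF g] by simp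
    also have "\<dots> = star G f z"
      using g_src[of "ginv G z", symmetric] src_inv[of z] by (simp add: star_def mult.commute)
    finally show "conv G (\<lambda>x. cnj (g x)) (star G k) z = star G f z" .
  qed
  then have sf: "\<pi> (star G f) \<zeta> = \<pi> (\<lambda>x. cnj (g x)) (\<pi> (star G k) \<zeta>)"
    using algebra_homD(5)[OF hom A0(5,3) \<zeta>] by simp
  define u where "u = \<pi> f \<eta>"
  define b where "b = \<pi> (star G k)"
  have b: "b \<in> bounded_operators H" "b \<zeta> \<in> carrier H"
    unfolding b_def using algebra_homD(1,2)[OF hom A0(3)] \<zeta> by auto
  have u: "u \<in> carrier H" and g\<eta>: "\<pi> g \<eta> \<in> carrier H"
    unfolding u_def using algebra_homD(2)[OF hom A0(1) \<eta>] algebra_homD(2)[OF hom A0(4) \<eta>] by auto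
  have bu: "b u = \<pi> g \<eta>"
    by (simp add: b_def u_def gkf)
  have "hnorm H u \<le> hnorm H (b u)"
    unfolding bu unfolding u_def fkg
    by (rule representation_contraction[OF H rep U k(1,2) g\<eta>])
  then have iso: "hinner H (b \<zeta>) (b u) = hinner H \<zeta> u"
    using contraction_preserves_inner[OF b(1)] representation_contraction[OF H rep V sk sk1] u \<zeta>
    unfolding b_def by blast
  have "hinner H (\<pi> f \<eta>) \<zeta> = cnj (hinner H (b \<zeta>) (\<pi> g \<eta>))"
    using inner_cnj[OF \<zeta> u] iso bu by (simp add: u_def)
  also have "\<dots> = hinner H (\<pi> g \<eta>) (b \<zeta>)"
    using inner_cnj[OF b(2) g\<eta>] by simp
  also have "\<dots> = hinner H \<eta> (\<pi> (\<lambda>x. cnj (g x)) (b \<zeta>))"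
    using rep g \<eta> b(2) by (auto simp: representation_def is_adjoint_def)
  also have "\<dots> = hinner H \<eta> (\<pi> (star G f) \<zeta>)"
    by (simp add: sf b_def)
  finally show "hinner H (\<pi> f \<eta>) \<zeta> = hinner H \<eta> (\<pi> (star G f) \<zeta>)" .
qed

text \<open>Both sides of the adjoint relation are linear in \<open>f\<close>, so that it extends from
  functions on bisections to their span. The two membership statements travel along in the induction
  because additivity of \<open>\<pi>\<close> is only known on the algebra.\<close>
lemma adjoint_on_A0:
  assumes H: "inner_product_space H" and hom: "algebra_hom G H \<pi>"
    and adj: "\<And>U f. bisection G U \<Longrightarrow> f \<in> Cc G U \<Longrightarrow> is_adjoint H (\<pi> f) (\<pi> (star G f))"
    and f: "f \<in> A0 G"
  shows "is_adjoint H (\<pi> f) (\<pi> (star G f))"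
proof -
  interpret inner_product_space H by (fact H)
  let ?P = "\<lambda>f. f \<in> A0 G \<and> star G f \<in> A0 G \<and> is_adjoint H (\<pi> f) (\<pi> (star G f))"
  have A0_add: "f + g \<in> A0 G" if "f \<in> A0 G" "g \<in> A0 G" for f g
    using that unfolding A0_def by (rule fscale.span_add)
  have A0_scale: "fscale c f \<in> A0 G" if "f \<in> A0 G" for c f
    using that unfolding A0_def by (rule fscale.span_scale)
  have scale: "?P (fscale c f)" if P: "?P f" for c f
  proof -
    have "is_adjoint H (\<pi> (fscale c f)) (\<pi> (fscale (cnj c) (star G f)))"
      using P algebra_homD(2,4)[OF hom, of f] algebra_homD(2,4)[OF hom, of "star G f"]
      by (auto simp: is_adjoint_def inner_smult_left inner_smult_right)
    then show ?thesis
      using P A0_scale by (simp add: star_fscale)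
  qed
  have add: "?P (f + g)" if P: "?P f" "?P g" for f g
  proof -
    have "is_adjoint H (\<pi> (f + g)) (\<pi> (star G f + star G g))"
      unfolding is_adjoint_def
    proof (intro ballI)
      fix \<xi> \<eta> assume c: "\<xi> \<in> carrier H" "\<eta> \<in> carrier H"
      have "hinner H (\<pi> f \<xi>) \<eta> = hinner H \<xi> (\<pi> (star G f) \<eta>)"
        "hinner H (\<pi> g \<xi>) \<eta> = hinner H \<xi> (\<pi> (star G g) \<eta>)"
        using P c by (auto simp: is_adjoint_def)
      then show "hinner H (\<pi> (f + g) \<xi>) \<eta> = hinner H \<xi> (\<pi> (star G f + star G g) \<eta>)"
        using P c by (simp add: algebra_homD(2,3)[OF hom] inner_add_left inner_add_right del: plus_fun_apply)
    qed
    then show ?thesis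
      using P A0_add by (simp add: star_add)
  qed
  have base: "?P f" if "bisection G U" "f \<in> Cc G U" for U f
    using that adj Cc_bisection_A0 star_Cc bisection_inverse(1) by blast
  have "?P 0"
  proof -
    have "0 \<in> Cc G (units G)"
      unfolding Cc_iff[OF bisection_open_Hausdorff[OF bisection_units]] zero_fun_def
      by (auto intro: exI[of _ "{}"])
    then show ?thesis
      using base[OF bisection_units] by blast
  qed
  then have "fscale.subspace (Collect ?P)"
    using add scale unfolding fscale.subspace_def by blast
  moreover have "(\<Union>U \<in> Collect (bisection G). Cc G U) \<subseteq> Collect ?P"
    using base by blast
  ultimately have "A0 G \<subseteq> Collect ?P"
    unfolding A0_eq_span_bisections by (rule fscale.span_minimal[rotated])
  then show ?thesis
    using f by blast
qed

text \<open>The usual bound for \<open>*\<close>-homomorphisms of commutative C*-algebras does not apply directly, since the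
  functions on the unit space form in general neither a complete nor a unital algebra. It suffices that
  \<open>M\<^sup>2 - h\<close> is the square of \<open>M - t\<close>, where \<open>t = M - sqrt (M\<^sup>2 - h)\<close> vanishes wherever \<open>h\<close> does and thus
  is compactly supported.\<close>
lemma star_representation_bound:
  assumes H: "inner_product_space H" and rep: "star_representation G H \<pi>"
    and U: "bisection G U" and f: "f \<in> Cc G U"
  shows "opnorm H (\<pi> f) \<le> supnorm f"
proof -
  interpret inner_product_space H by (fact H)
  have hom: "algebra_hom G H \<pi>"
    and adj: "\<And>f \<xi> \<eta>. f \<in> A0 G \<Longrightarrow> \<xi> \<in> carrier H \<Longrightarrow> \<eta> \<in> carrier H \<Longrightarrow>
      hinner H (\<pi> f \<xi>) \<eta> = hinner H \<xi> (\<pi> (star G f) \<eta>)"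
    using rep by (auto simp: star_representation_def is_adjoint_def)
  define M where "M = supnorm f"
  have fM: "cmod (f x) \<le> M" for x
    unfolding M_def using bisection_open_Hausdorff[OF U] f by (rule cmod_le_supnorm)
  have M: "0 \<le> M"
    using fM[of undefined] norm_ge_zero[of "f undefined"] by linarith
  \<comment> \<open>As \<open>h = \<bar>g\<bar>\<^sup>2\<close>, the function \<open>t\<close> is a continuous function of \<open>g\<close>.\<close>
  define \<phi> where "\<phi> w = complex_of_real (M - sqrt (M\<^sup>2 - (cmod w)\<^sup>2))" for w
  define g where "g = src_pushforward G U f"
  define t where "t = (\<lambda>x. \<phi> (g x))"
  define h where "h = src_pushforward G U (\<lambda>x. cnj (f x) * f x)"
  have units: "open_Hausdorff G (units G)"
    by (rule bisection_open_Hausdorff[OF bisection_units])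
  have t: "t \<in> Cc G (units G)"
    unfolding t_def g_def using units src_pushforward_Cc[OF U f]
  proof (rule Cc_compose)
    show "continuous_on UNIV \<phi>"
      unfolding \<phi>_def by (intro continuous_intros)
    show "\<phi> 0 = 0"
      using M by (simp add: \<phi>_def)
  qed
  have st: "star G t = t"
    using star_units[OF t] by (simp add: t_def \<phi>_def)
  have tt: "conv G t t = (\<lambda>x. t x * t x)"
  proof
    fix x
    have "t y = 0" if "y \<notin> arrows G" for y
      using CcD(2)[OF t, of y] unitsD(1)[of y] that by blast
    then have "conv G t t x = t x * t (src G x)"
      using conv_unit_right[of t t] CcD(2)[OF t] by simp
    then show "conv G t t x = t x * t x"
      using CcD(2)[OF t, of x] unitsD(2)[of x] by (cases "x \<in> units G") simp_all
  qed
  have h_eq: "h = fscale (complex_of_real (2 * M)) t + fscale (- 1) (conv G t t)"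
  proof
    fix x
    have gM: "cmod (g x) \<le> M"
      using fM M by (auto simp: g_def src_pushforward_def)
    then have "(cmod (g x))\<^sup>2 \<le> M\<^sup>2"
      by (intro power_mono) auto
    then have sq: "(sqrt (M\<^sup>2 - (cmod (g x))\<^sup>2))\<^sup>2 = M\<^sup>2 - (cmod (g x))\<^sup>2"
      by simp
    have "2 * M * (M - s) - (M - s) * (M - s) = M\<^sup>2 - s\<^sup>2" for s :: real
      by (simp add: power2_eq_square algebra_simps)
    from this[of "sqrt (M\<^sup>2 - (cmod (g x))\<^sup>2)"] sq
    have "2 * M * (M - sqrt (M\<^sup>2 - (cmod (g x))\<^sup>2))
        - (M - sqrt (M\<^sup>2 - (cmod (g x))\<^sup>2)) * (M - sqrt (M\<^sup>2 - (cmod (g x))\<^sup>2)) = (cmod (g x))\<^sup>2"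
      by simp
    then have "complex_of_real (2 * M) * t x - t x * t x = complex_of_real ((cmod (g x))\<^sup>2)"
      unfolding t_def \<phi>_def by (simp only: of_real_mult[symmetric] of_real_diff[symmetric])
    also have "\<dots> = h x"
      by (simp add: complex_norm_square h_def g_def src_pushforward_def mult.commute del: of_real_power)
    finally show "h x = (fscale (complex_of_real (2 * M)) t + fscale (- 1) (conv G t t)) x"
      by (simp add: tt fscale_def)
  qed
  have A0: "f \<in> A0 G" "t \<in> A0 G" "star G f \<in> A0 G"
    using Cc_bisection_A0 f t U bisection_units star_Cc bisection_inverse(1) by blast+
  have "conv G t t \<in> Cc G (units G)"
    unfolding tt using units t CcD(1)[OF t] by (rule Cc_mult)
  then have ttA0: "conv G t t \<in> A0 G"
    using Cc_bisection_A0 bisection_units by blast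
  have scA0: "fscale c k \<in> A0 G" if "k \<in> A0 G" for c k
    using that unfolding A0_def by (rule fscale.span_scale)
  have conv_h: "conv G (star G f) f = h"
    using conv_star_bisection[OF U, of f f] CcD(2)[OF f] by (simp add: h_def)
  have "hnorm H (\<pi> f \<xi>) \<le> M * hnorm H \<xi>" if \<xi>: "\<xi> \<in> carrier H" for \<xi>
  proof -
    define \<tau> where "\<tau> = \<pi> t \<xi>"
    have \<tau>: "\<tau> \<in> carrier H" "\<pi> f \<xi> \<in> carrier H" "\<pi> t \<tau> \<in> carrier H"
      unfolding \<tau>_def using algebra_homD(2)[OF hom] A0 \<xi> by auto
    have "\<pi> h \<xi> = complex_of_real (2 * M) \<odot>\<^bsub>H\<^esub> \<tau> \<oplus>\<^bsub>H\<^esub> (- 1) \<odot>\<^bsub>H\<^esub> \<pi> t \<tau>"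
      unfolding h_eq \<tau>_def algebra_homD(3)[OF hom scA0[OF A0(2)] scA0[OF ttA0] \<xi>]
      by (simp only: algebra_homD(4)[OF hom A0(2) \<xi>] algebra_homD(4)[OF hom ttA0 \<xi>]
          algebra_homD(5)[OF hom A0(2) A0(2) \<xi>])
    then have "hinner H \<xi> (\<pi> h \<xi>) = complex_of_real (2 * M) * hinner H \<xi> \<tau> - hinner H \<xi> (\<pi> t \<tau>)"
      using \<xi> \<tau> by (simp add: inner_add_right inner_smult_right)
    moreover have "hinner H \<xi> (\<pi> t \<tau>) = hinner H \<tau> \<tau>"
      using adj[OF A0(2) \<xi> \<tau>(1)] by (simp add: st \<tau>_def)
    moreover have "hinner H (\<pi> f \<xi>) (\<pi> f \<xi>) = hinner H \<xi> (\<pi> h \<xi>)"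
      using adj[OF A0(1) \<xi> \<tau>(2)] algebra_homD(5)[OF hom A0(3,1) \<xi>] by (simp add: conv_h)
    ultimately have "(hnorm H (\<pi> f \<xi>))\<^sup>2 = 2 * M * Re (hinner H \<xi> \<tau>) - (hnorm H \<tau>)\<^sup>2"
      using \<tau> by (simp add: hnorm_square)
    moreover have "0 \<le> (hnorm H \<tau>)\<^sup>2 - 2 * M * Re (hinner H \<xi> \<tau>) + M\<^sup>2 * (hnorm H \<xi>)\<^sup>2"
      using hnorm_add_smult_square[OF \<tau>(1) \<xi>, of "complex_of_real (- M)"] inner_cnj[OF \<xi> \<tau>(1)]
        zero_le_power2[of "hnorm H (\<tau> \<oplus>\<^bsub>H\<^esub> complex_of_real (- M) \<odot>\<^bsub>H\<^esub> \<xi>)"]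
      by simp
    ultimately have "(hnorm H (\<pi> f \<xi>))\<^sup>2 \<le> (M * hnorm H \<xi>)\<^sup>2"
      by (simp add: power_mult_distrib)
    then show ?thesis
      by (rule power2_le_imp_le) (use M hnorm_nonneg[OF \<xi>] in simp)
  qed
  then show ?thesis
    unfolding M_def[symmetric] using M by (intro opnorm_least)
qed

theorem representation_iff_star_representation:
  assumes H: "inner_product_space H"
  shows "representation G H \<pi> \<longleftrightarrow> star_representation G H \<pi>"
proof
  assume rep: "representation G H \<pi>"
  then have hom: "algebra_hom G H \<pi>"
    by (simp add: representation_def)
  show "star_representation G H \<pi>"
    using hom adjoint_on_A0[OF H hom] representation_adjoint_bisection[OF H rep]
    by (auto simp: star_representation_def)
next
  assume rep: "star_representation G H \<pi>"
  have "is_adjoint H (\<pi> f) (\<pi> (\<lambda>x. cnj (f x)))" if "f \<in> Cc G (units G)" for f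
    using rep star_units[OF that] Cc_bisection_A0[OF bisection_units that]
    by (auto simp: star_representation_def)
  then show "representation G H \<pi>"
    using rep star_representation_bound[OF H rep]
    by (auto simp: representation_def star_representation_def)
qed

end

theorem theorem3p25:
  fixes G :: "'g groupoid"
  assumes "etale_groupoid G"
    and "second_countable (unit_space G)"
  shows "\<forall>f \<in> A0 G. A_seminorm TYPE('h) G f = Cstar_norm TYPE('h) G f"
proof -
  interpret etale_groupoid G by (fact assms(1))
  have "hilbert_space H \<and> representation G H \<pi> \<longleftrightarrow> hilbert_space H \<and> star_representation G H \<pi>"
    for H :: "'h hilbert" and \<pi>
    using representation_iff_star_representation[OF hilbert_space.axioms(1)] by blast
  then show ?thesis
    unfolding A_seminorm_def Cstar_norm_def by simp
qed

end
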